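(* Let $\alpha_0,\dots,\alpha_5$ be complex parameters with $2\alpha_0+2\alpha_1+2\alpha_2+2\alpha_3+\alpha_4+\alpha_5=1$, and consider the Hamiltonian system $$\frac{dx}{dt}=\frac{\partial H}{\partial y},\ \frac{dy}{dt}=-\frac{\partial H}{\partial x},\ \frac{dz}{dt}=\frac{\partial H}{\partial w},\ \frac{dw}{dt}=-\frac{\partial H}{\partial z},\ \frac{dq}{dt}=\frac{\partial H}{\partial p},\ \frac{dp}{dt}=-\frac{\partial H}{\partial q}$$ with $$\begin{aligned} tH={}&x^2y^2+2\alpha_0xy+x+ty+z^2w^2+2(\alpha_0+\alpha_1+\alpha_2)zw+tw\\&+q^2p^2-tq^2p+(\alpha_4+\alpha_5-1)qp-\alpha_4tq+2yz(zw+\alpha_2)-2(y+w)p.\end{aligned}$$ Make the change of parameters and variables $$\alpha_0=\frac{A_1-A_0}{2},\ \alpha_1=A_0,\ \alpha_2=A_2,\ \alpha_3=A_3,\ \alpha_4=A_4,\ \alpha_5=A_5,$$ $$X=((x-z)y-\alpha_1)y,\ Y=-\frac1y,\ Z=z,\ W=w+y,\ Q=q,\ P=p$$ from $\alpha_0,\dots,\alpha_5,x,y,z,w,q,p$ to $A_0,\dots,A_5,X,Y,Z,W,Q,P$. Then the system, written in the new variables and parameters, is the Hamiltonian system (in the canonical pairs $(X,Y),(Z,W),(Q,P)$, with the same time $t$) with the polynomial Hamiltonian $$\begin{aligned}&\frac{X^2Y^2+XY^2-(A_0+A_1)XY-A_0Y}{t}+\frac{Z^2W^2+(A_0+A_1+2A_2)ZW+Z+tW}{t}\\&+\frac{Q^2P^2-tQ^2P-(1-A_4-A_5)QP-A_4tQ}{t}+\frac{2(XZ-WP)}{t},\end{aligned}$$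 where $A_0+A_1+2A_2+2A_3+A_4+A_5=1$.
   Context: A Hamiltonian system with Hamiltonian $K$ in canonical pairs $(X,Y),(Z,W),(Q,P)$ and time $t$ means $\frac{dX}{dt}=\frac{\partial K}{\partial Y},\ \frac{dY}{dt}=-\frac{\partial K}{\partial X}$, and similarly for $(Z,W)$ and $(Q,P)$. Hamiltonians are considered up to additive functions of $t$ only. *)

theory Defs
  imports "HOL-Analysis.Analysis"
begin

text \<open>
  A Hamiltonian takes the time first and then the canonical coordinates in the order
  \<open>x, y, z, w, q, p\<close>, the canonical pairs being \<open>(x, y)\<close>, \<open>(z, w)\<close>, \<open>(q, p)\<close>.
\<close>

type_synonym phase_fun =
  "complex \<Rightarrow> complex \<Rightarrow> complex \<Rightarrow> complex \<Rightarrow> complex \<Rightarrow> complex \<Rightarrow> complex"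

definition hamiltonian_solution ::
  "(complex \<Rightarrow> phase_fun) \<Rightarrow> complex set \<Rightarrow>
   (complex \<Rightarrow> complex) \<Rightarrow> (complex \<Rightarrow> complex) \<Rightarrow> (complex \<Rightarrow> complex) \<Rightarrow>
   (complex \<Rightarrow> complex) \<Rightarrow> (complex \<Rightarrow> complex) \<Rightarrow> (complex \<Rightarrow> complex) \<Rightarrow> bool" where
  "hamiltonian_solution K T x y z w q p \<longleftrightarrow> (\<forall>t\<in>T.
     (x has_field_derivative deriv (\<lambda>v. K t (x t) v (z t) (w t) (q t) (p t)) (y t)) (at t) \<and>
     (y has_field_derivative - deriv (\<lambda>v. K t v (y t) (z t) (w t) (q t) (p t)) (x t)) (at t) \<and>
     (z has_field_derivative deriv (\<lambda>v. K t (x t) (y t) (z t) v (q t) (p t)) (w t)) (at t) \<and>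
     (w has_field_derivative - deriv (\<lambda>v. K t (x t) (y t) v (w t) (q t) (p t)) (z t)) (at t) \<and>
     (q has_field_derivative deriv (\<lambda>v. K t (x t) (y t) (z t) (w t) (q t) v) (p t)) (at t) \<and>
     (p has_field_derivative - deriv (\<lambda>v. K t (x t) (y t) (z t) (w t) v (p t)) (q t)) (at t))"

inductive polynomial6 :: "phase_fun \<Rightarrow> bool" where
  const: "polynomial6 (\<lambda>x y z w q p. c)"
| coord1: "polynomial6 (\<lambda>x y z w q p. x)"
| coord2: "polynomial6 (\<lambda>x y z w q p. y)"
| coord3: "polynomial6 (\<lambda>x y z w q p. z)"
| coord4: "polynomial6 (\<lambda>x y z w q p. w)"
| coord5: "polynomial6 (\<lambda>x y z w q p. q)"
| coord6: "polynomial6 (\<lambda>x y z w q p. p)"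
| add: "\<lbrakk>polynomial6 f; polynomial6 g\<rbrakk> \<Longrightarrow>
    polynomial6 (\<lambda>x y z w q p. f x y z w q p + g x y z w q p)"
| mult: "\<lbrakk>polynomial6 f; polynomial6 g\<rbrakk> \<Longrightarrow>
    polynomial6 (\<lambda>x y z w q p. f x y z w q p * g x y z w q p)"

text \<open>The two Hamiltonians; both are only meaningful for \<open>t \<noteq> 0\<close>.\<close>

definition H_old ::
  "complex \<Rightarrow> complex \<Rightarrow> complex \<Rightarrow> complex \<Rightarrow> complex \<Rightarrow> complex \<Rightarrow> phase_fun" where
  "H_old a0 a1 a2 a4 a5 t x y z w q p =
     (x^2 * y^2 + 2 * a0 * x * y + x + t * y
      + z^2 * w^2 + 2 * (a0 + a1 + a2) * z * w + t * w
      + q^2 * p^2 - t * q^2 * p + (a4 + a5 - 1) * q * p - a4 * t * q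
      + 2 * y * z * (z * w + a2) - 2 * (y + w) * p) / t"

definition H_new ::
  "complex \<Rightarrow> complex \<Rightarrow> complex \<Rightarrow> complex \<Rightarrow> complex \<Rightarrow> complex \<Rightarrow> phase_fun" where
  "H_new A0 A1 A2 A4 A5 t X Y Z W Q P =
     (X^2 * Y^2 + X * Y^2 - (A0 + A1) * X * Y - A0 * Y) / t
     + (Z^2 * W^2 + (A0 + A1 + 2 * A2) * Z * W + Z + t * W) / t
     + (Q^2 * P^2 - t * Q^2 * P - (1 - A4 - A5) * Q * P - A4 * t * Q) / t
     + 2 * (X * Z - W * P) / t"

text \<open>The change of variables, defined where \<open>y \<noteq> 0\<close>.\<close>

definition new_vars ::
  "complex \<Rightarrow> complex \<times> complex \<times> complex \<times> complex \<times> complex \<times> complex \<Rightarrow>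
   complex \<times> complex \<times> complex \<times> complex \<times> complex \<times> complex" where
  "new_vars a1 = (\<lambda>(x, y, z, w, q, p).
     (((x - z) * y - a1) * y, - 1 / y, z, w + y, q, p))"

end

theory Submission
  imports Defs
begin

text \<open>
  The change of variables is independent of the time and symplectic: since \<open>Y = - 1 / y\<close>, one has
  \<open>dX \<and> dY = (dx - dz) \<and> dy\<close>, and the surplus \<open>- dz \<and> dy\<close> is exactly compensated by
  \<open>dZ \<and> dW = dz \<and> (dw + dy)\<close>. A symplectic map carries the Hamiltonian system of \<open>K \<circ> new_vars\<close>
  to that of \<open>K\<close>, and for the given parameters \<open>H_old\<close> is \<open>H_new \<circ> new_vars\<close> up to a function of
  the time.

  Only gradients enter the equations of motion, so composition is expressed through them. The lemma
  \<open>gradient_pullback\<close> says that the gradient of \<open>H_old\<close> is the gradient of \<open>H_new\<close>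
  multiplied by the transposed Jacobian matrix of the change of variables. The lemma
  \<open>canonical_equations_new_vars\<close> shows that any two gradients related in this way give equivalent
  canonical equations; this is where symplecticity is used. Its backward direction differentiates
  the explicit inverse \<open>old_vars\<close>, which also gives bijectivity.
\<close>

section \<open>Polynomial Hamiltonians\<close>

lemma polynomial6_diff:
  assumes "polynomial6 f" "polynomial6 g"
  shows "polynomial6 (\<lambda>x y z w q p. f x y z w q p - g x y z w q p)"
proof -
  have "polynomial6 (\<lambda>x y z w q p. f x y z w q p + (- 1) * g x y z w q p)"
    by (intro polynomial6.add polynomial6.mult polynomial6.const assms)
  then show ?thesis by simp
qed

lemma polynomial6_divide_const:
  assumes "polynomial6 f"
  shows "polynomial6 (\<lambda>x y z w q p. f x y z w q p / c)"
  unfolding divide_inverse by (intro polynomial6.mult polynomial6.const assms)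

lemma polynomial6_power:
  assumes "polynomial6 f"
  shows "polynomial6 (\<lambda>x y z w q p. f x y z w q p ^ n)"
  by (induction n) (auto intro: polynomial6.const polynomial6.mult assms)

lemma polynomial6_H_new: "polynomial6 (H_new A0 A1 A2 A4 A5 t)"
  unfolding H_new_def[abs_def]
  by (rule polynomial6.const polynomial6.coord1 polynomial6.coord2 polynomial6.coord3
      polynomial6.coord4 polynomial6.coord5 polynomial6.coord6 polynomial6_divide_const
      polynomial6_power polynomial6_diff polynomial6.add polynomial6.mult)+

section \<open>The inverse change of variables\<close>

definition old_vars ::
  "complex \<Rightarrow> complex \<times> complex \<times> complex \<times> complex \<times> complex \<times> complex \<Rightarrow>
   complex \<times> complex \<times> complex \<times> complex \<times> complex \<times> complex" where
  "old_vars a = (\<lambda>(X, Y, Z, W, Q, P).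
     (Z + X * Y^2 - a * Y, - 1 / Y, Z, W + 1 / Y, Q, P))"

lemma old_vars_new_vars:
  assumes "y \<noteq> 0"
  shows "old_vars a (new_vars a (x, y, z, w, q, p)) = (x, y, z, w, q, p)"
  using assms by (simp add: old_vars_def new_vars_def field_simps power2_eq_square)

lemma new_vars_old_vars:
  assumes "Y \<noteq> 0"
  shows "new_vars a (old_vars a (X, Y, Z, W, Q, P)) = (X, Y, Z, W, Q, P)"
  using assms by (simp add: old_vars_def new_vars_def field_simps power2_eq_square)

lemma bij_betw_new_vars:
  "bij_betw (new_vars a) {(x, y, z, w, q, p). y \<noteq> 0} {(X, Y, Z, W, Q, P). Y \<noteq> 0}"
proof (rule bij_betw_byWitness[where f' = "old_vars a"])
  show "\<forall>v\<in>{(x, y, z, w, q, p). y \<noteq> 0}. old_vars a (new_vars a v) = v"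
    by (clarsimp simp: old_vars_new_vars)
  show "\<forall>V\<in>{(X, Y, Z, W, Q, P). Y \<noteq> 0}. new_vars a (old_vars a V) = V"
    by (clarsimp simp: new_vars_old_vars)
  show "new_vars a ` {(x, y, z, w, q, p). y \<noteq> 0} \<subseteq> {(X, Y, Z, W, Q, P). Y \<noteq> 0}"
    by (auto simp: new_vars_def)
  show "old_vars a ` {(X, Y, Z, W, Q, P). Y \<noteq> 0} \<subseteq> {(x, y, z, w, q, p). y \<noteq> 0}"
    by (auto simp: old_vars_def)
qed

section \<open>Symplecticity\<close>

text \<open>
  The hypotheses \<open>Hx\<close> to \<open>Hp\<close> are the chain rule for a function \<open>H = K \<circ> new_vars a\<close> at the point
  reached at time \<open>t\<close>. The terms with \<open>KX\<close> cancel in the velocity of \<open>X\<close>, leaving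
  \<open>y^2 * (Hy - Hw) - (2 * (x - z) * y - a) * Hx = KY\<close>; that cancellation is
  an instance of the symplectic condition.
\<close>

lemma canonical_equations_new_vars:
  fixes T :: "complex set"
  assumes T: "open T" "t \<in> T"
    and nz: "\<And>s. s \<in> T \<Longrightarrow> y s \<noteq> 0"
    and new: "\<And>s. s \<in> T \<Longrightarrow>
      (X s, Y s, Z s, W s, Q s, P s) = new_vars a (x s, y s, z s, w s, q s, p s)"
    and Hx: "Hx = KX * (y t)^2"
    and Hy: "Hy = KX * (2 * (x t - z t) * y t - a) + KY / (y t)^2 + KW"
    and Hz: "Hz = KZ - KX * (y t)^2" and Hw: "Hw = KW" and Hq: "Hq = KQ" and Hp: "Hp = KP"
  shows
    "((x has_field_derivative Hy) (at t) \<and> (y has_field_derivative - Hx) (at t) \<and>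
      (z has_field_derivative Hw) (at t) \<and> (w has_field_derivative - Hz) (at t) \<and>
      (q has_field_derivative Hp) (at t) \<and> (p has_field_derivative - Hq) (at t)) \<longleftrightarrow>
     ((X has_field_derivative KY) (at t) \<and> (Y has_field_derivative - KX) (at t) \<and>
      (Z has_field_derivative KW) (at t) \<and> (W has_field_derivative - KZ) (at t) \<and>
      (Q has_field_derivative KP) (at t) \<and> (P has_field_derivative - KQ) (at t))"
    (is "?old \<longleftrightarrow> ?new")
proof -
  have new_eqs: "X s = ((x s - z s) * y s - a) * y s" "Y s = - 1 / y s" "Z s = z s"
    "W s = w s + y s" "Q s = q s" "P s = p s" if "s \<in> T" for s
    using new[OF that] by (simp_all add: new_vars_def)
  have old_eqs: "x s = Z s + X s * (Y s)^2 - a * Y s" "y s = - 1 / Y s" "z s = Z s"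
    "w s = W s + 1 / Y s" "q s = Q s" "p s = P s" if "s \<in> T" for s
  proof -
    have "(x s, y s, z s, w s, q s, p s) = old_vars a (X s, Y s, Z s, W s, Q s, P s)"
      using old_vars_new_vars[OF nz[OF that]] new[OF that] by simp
    then show "x s = Z s + X s * (Y s)^2 - a * Y s" "y s = - 1 / Y s" "z s = Z s"
      "w s = W s + 1 / Y s" "q s = Q s" "p s = P s"
      by (simp_all add: old_vars_def)
  qed
  have y0: "y t \<noteq> 0" and Y0: "Y t \<noteq> 0"
    using nz[OF T(2)] new_eqs(2)[OF T(2)] by auto
  have cong: "(f has_field_derivative D) (at t)"
    if "(g has_field_derivative D) (at t)" "\<And>s. s \<in> T \<Longrightarrow> f s = g s"
    for f g :: "complex \<Rightarrow> complex" and D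
    using has_field_derivative_transform_within_open[OF that(1) T] that(2) by simp
  show ?thesis
  proof
    assume ?old
    then have d: "(x has_field_derivative Hy) (at t)" "(y has_field_derivative - Hx) (at t)"
      "(z has_field_derivative Hw) (at t)" "(w has_field_derivative - Hz) (at t)"
      "(q has_field_derivative Hp) (at t)" "(p has_field_derivative - Hq) (at t)" by auto
    have "((\<lambda>s. ((x s - z s) * y s - a) * y s) has_field_derivative KY) (at t)"
      using y0 by (auto intro!: derivative_eq_intros d
          simp: Hx Hy Hw field_simps power2_eq_square)
    moreover have "((\<lambda>s. - 1 / y s) has_field_derivative - KX) (at t)"
      using y0 by (auto intro!: derivative_eq_intros d simp: Hx field_simps power2_eq_square)
    moreover have "((\<lambda>s. w s + y s) has_field_derivative - KZ) (at t)"
      by (auto intro!: derivative_eq_intros d simp: Hx Hz)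
    ultimately show ?new
      using d(3,5,6) by (auto intro: cong simp: new_eqs Hw Hp Hq)
  next
    assume ?new
    then have d: "(X has_field_derivative KY) (at t)" "(Y has_field_derivative - KX) (at t)"
      "(Z has_field_derivative KW) (at t)" "(W has_field_derivative - KZ) (at t)"
      "(Q has_field_derivative KP) (at t)" "(P has_field_derivative - KQ) (at t)" by auto
    have "((\<lambda>s. Z s + X s * (Y s)^2 - a * Y s) has_field_derivative Hy) (at t)"
      using y0 by (auto intro!: derivative_eq_intros d
          simp: Hy new_eqs[OF T(2)] field_simps power2_eq_square)
    moreover have "((\<lambda>s. - 1 / Y s) has_field_derivative - Hx) (at t)"
      using Y0 y0 by (auto intro!: derivative_eq_intros d
          simp: Hx new_eqs(2)[OF T(2)] field_simps power2_eq_square)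
    moreover have "((\<lambda>s. W s + 1 / Y s) has_field_derivative - Hz) (at t)"
      using Y0 y0 by (auto intro!: derivative_eq_intros d
          simp: Hz new_eqs(2)[OF T(2)] field_simps power2_eq_square)
    ultimately show ?old
      using d(3,5,6) by (auto intro: cong simp: old_eqs Hw Hp Hq)
  qed
qed

section \<open>The gradients of the two Hamiltonians\<close>

lemma deriv_H_old:
  assumes "t \<noteq> 0"
  shows
    "deriv (\<lambda>v. H_old a0 a1 a2 a4 a5 t v y z w q p) x = (2 * x * y^2 + 2 * a0 * y + 1) / t"
    "deriv (\<lambda>v. H_old a0 a1 a2 a4 a5 t x v z w q p) y =
       (2 * x^2 * y + 2 * a0 * x + t + 2 * z * (z * w + a2) - 2 * p) / t"
    "deriv (\<lambda>v. H_old a0 a1 a2 a4 a5 t x y v w q p) z =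
       (2 * z * w^2 + 2 * (a0 + a1 + a2) * w + 4 * y * z * w + 2 * a2 * y) / t"
    "deriv (\<lambda>v. H_old a0 a1 a2 a4 a5 t x y z v q p) w =
       (2 * z^2 * w + 2 * (a0 + a1 + a2) * z + t + 2 * y * z^2 - 2 * p) / t"
    "deriv (\<lambda>v. H_old a0 a1 a2 a4 a5 t x y z w v p) q =
       (2 * q * p^2 - 2 * t * q * p + (a4 + a5 - 1) * p - a4 * t) / t"
    "deriv (\<lambda>v. H_old a0 a1 a2 a4 a5 t x y z w q v) p =
       (2 * q^2 * p - t * q^2 + (a4 + a5 - 1) * q - 2 * (y + w)) / t"
  unfolding H_old_def
  by (rule DERIV_imp_deriv,
      (auto intro!: derivative_eq_intros simp: assms field_simps power2_eq_square)[1])+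

lemma deriv_H_new:
  assumes "t \<noteq> 0"
  shows
    "deriv (\<lambda>v. H_new A0 A1 A2 A4 A5 t v Y Z W Q P) X =
       (2 * X * Y^2 + Y^2 - (A0 + A1) * Y + 2 * Z) / t"
    "deriv (\<lambda>v. H_new A0 A1 A2 A4 A5 t X v Z W Q P) Y =
       (2 * X^2 * Y + 2 * X * Y - (A0 + A1) * X - A0) / t"
    "deriv (\<lambda>v. H_new A0 A1 A2 A4 A5 t X Y v W Q P) Z =
       (2 * Z * W^2 + (A0 + A1 + 2 * A2) * W + 1 + 2 * X) / t"
    "deriv (\<lambda>v. H_new A0 A1 A2 A4 A5 t X Y Z v Q P) W =
       (2 * Z^2 * W + (A0 + A1 + 2 * A2) * Z + t - 2 * P) / t"
    "deriv (\<lambda>v. H_new A0 A1 A2 A4 A5 t X Y Z W v P) Q =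
       (2 * Q * P^2 - 2 * t * Q * P - (1 - A4 - A5) * P - A4 * t) / t"
    "deriv (\<lambda>v. H_new A0 A1 A2 A4 A5 t X Y Z W Q v) P =
       (2 * Q^2 * P - t * Q^2 - (1 - A4 - A5) * Q - 2 * W) / t"
  unfolding H_new_def
  by (rule DERIV_imp_deriv,
      (auto intro!: derivative_eq_intros simp: assms field_simps power2_eq_square)[1])+

text \<open>
  These identities hold because \<open>H_new \<circ> new_vars A0\<close> and \<open>H_old\<close> differ by a function of \<open>t\<close>
  alone when \<open>a0 = (A1 - A0) / 2\<close>. They are checked on the explicit gradients, after clearing the
  denominators \<open>t\<close> and \<open>y\<close>.
\<close>

lemma gradient_pullback:
  fixes A0 A1 A2 A4 A5 :: complex
  assumes t: "t \<noteq> 0" and y: "y \<noteq> 0"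
    and new: "(X, Y, Z, W, Q, P) = new_vars A0 (x, y, z, w, q, p)"
  defines "H \<equiv> H_old ((A1 - A0) / 2) A0 A2 A4 A5" and "K \<equiv> H_new A0 A1 A2 A4 A5"
  shows
    "deriv (\<lambda>v. H t v y z w q p) x = deriv (\<lambda>v. K t v Y Z W Q P) X * y^2"
    "deriv (\<lambda>v. H t x v z w q p) y =
       deriv (\<lambda>v. K t v Y Z W Q P) X * (2 * (x - z) * y - A0) +
       deriv (\<lambda>v. K t X v Z W Q P) Y / y^2 + deriv (\<lambda>v. K t X Y Z v Q P) W"
    "deriv (\<lambda>v. H t x y v w q p) z =
       deriv (\<lambda>v. K t X Y v W Q P) Z - deriv (\<lambda>v. K t v Y Z W Q P) X * y^2"
    "deriv (\<lambda>v. H t x y z v q p) w = deriv (\<lambda>v. K t X Y Z v Q P) W"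
    "deriv (\<lambda>v. H t x y z w v p) q = deriv (\<lambda>v. K t X Y Z W v P) Q"
    "deriv (\<lambda>v. H t x y z w q v) p = deriv (\<lambda>v. K t X Y Z W Q v) P"
proof -
  have eqs: "X = ((x - z) * y - A0) * y" "Y = - 1 / y" "Z = z" "W = w + y" "Q = q" "P = p"
    using new by (simp_all add: new_vars_def)
  show
    "deriv (\<lambda>v. H t v y z w q p) x = deriv (\<lambda>v. K t v Y Z W Q P) X * y^2"
    "deriv (\<lambda>v. H t x v z w q p) y =
       deriv (\<lambda>v. K t v Y Z W Q P) X * (2 * (x - z) * y - A0) +
       deriv (\<lambda>v. K t X v Z W Q P) Y / y^2 + deriv (\<lambda>v. K t X Y Z v Q P) W"
    "deriv (\<lambda>v. H t x y v w q p) z =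
       deriv (\<lambda>v. K t X Y v W Q P) Z - deriv (\<lambda>v. K t v Y Z W Q P) X * y^2"
    "deriv (\<lambda>v. H t x y z v q p) w = deriv (\<lambda>v. K t X Y Z v Q P) W"
    "deriv (\<lambda>v. H t x y z w v p) q = deriv (\<lambda>v. K t X Y Z W v P) Q"
    "deriv (\<lambda>v. H t x y z w q v) p = deriv (\<lambda>v. K t X Y Z W Q v) P"
    unfolding H_def K_def deriv_H_old[OF t] deriv_H_new[OF t] eqs
    using t y by (simp_all add: field_simps power2_eq_square)
qed

section \<open>Equivalence of the two systems\<close>

lemma hamiltonian_solution_new_vars:
  fixes T :: "complex set"
  assumes "open T" "0 \<notin> T" "\<forall>t\<in>T. y t \<noteq> 0"
    and "\<forall>t\<in>T. (X t, Y t, Z t, W t, Q t, P t) = new_vars A0 (x t, y t, z t, w t, q t, p t)"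
  shows "hamiltonian_solution (H_old ((A1 - A0) / 2) A0 A2 A4 A5) T x y z w q p \<longleftrightarrow>
    hamiltonian_solution (H_new A0 A1 A2 A4 A5) T X Y Z W Q P"
  unfolding hamiltonian_solution_def
proof (intro ball_cong refl, goal_cases)
  case t: (1 t)
  then have "t \<noteq> 0" "y t \<noteq> 0"
    and "(X t, Y t, Z t, W t, Q t, P t) = new_vars A0 (x t, y t, z t, w t, q t, p t)"
    using assms by auto
  note pullback = gradient_pullback[OF this]
  show ?case
    by (rule canonical_equations_new_vars[OF assms(1) t, where a = A0])
      (use assms pullback in auto)
qed

theorem theorem3p8:
  fixes a0 a1 a2 a3 a4 a5 A0 A1 A2 A3 A4 A5 :: complex
  assumes "2 * a0 + 2 * a1 + 2 * a2 + 2 * a3 + a4 + a5 = 1"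
    and "a0 = (A1 - A0) / 2" and "a1 = A0" and "a2 = A2"
    and "a3 = A3" and "a4 = A4" and "a5 = A5"
  shows "A0 + A1 + 2 * A2 + 2 * A3 + A4 + A5 = 1 \<and>
    (\<forall>t. polynomial6 (H_new A0 A1 A2 A4 A5 t)) \<and>
    bij_betw (new_vars a1) {(x, y, z, w, q, p). y \<noteq> 0} {(X, Y, Z, W, Q, P). Y \<noteq> 0} \<and>
    (\<forall>(T :: complex set) x y z w q p X Y Z W Q P.
      open T \<longrightarrow> 0 \<notin> T \<longrightarrow> (\<forall>t\<in>T. y t \<noteq> 0) \<longrightarrow>
      (\<forall>t\<in>T. (X t, Y t, Z t, W t, Q t, P t) = new_vars a1 (x t, y t, z t, w t, q t, p t)) \<longrightarrow>
      (hamiltonian_solution (H_old a0 a1 a2 a4 a5) T x y z w q p \<longleftrightarrow>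
       hamiltonian_solution (H_new A0 A1 A2 A4 A5) T X Y Z W Q P))"
proof -
  have "A0 + A1 + 2 * A2 + 2 * A3 + A4 + A5 = 1"
  proof -
    have "A1 = A0 + 2 * a0" using assms(2) by (simp add: field_simps)
    then show ?thesis using assms(1) unfolding assms(3-7) by algebra
  qed
  then show ?thesis
    unfolding assms(2-7)
    by (intro conjI allI impI polynomial6_H_new bij_betw_new_vars hamiltonian_solution_new_vars)
qed

end
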